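(* Let $X$ be a Banach space over $\mathbb{K}\in\{\mathbb{R},\mathbb{C}\}$, $m\in\mathbb{N}^+$, and suppose $T\in B(X)$ is an $(m,\infty)$-isometry. Then $T$ is an $(m+1,\infty)$-isometry.
   Context: $\mathbb{N}^+$ denotes the positive integers; $B(X)$ is the algebra of bounded linear operators on $X$. For $m\in\mathbb{N}^+$, an operator $T\in B(X)$ is an $(m,\infty)$-isometry if for all $x\in X$ $$\max_{\substack{k=0,\dots,m\\ k\text{ even}}}\|T^kx\|=\max_{\substack{k=0,\dots,m\\ k\text{ odd}}}\|T^kx\|.$$ *)

theory Defs
  imports Complex_Main
begin

(* A complex normed space: a real normed space whose real scalar multiplication is the
   restriction of a complex one, with norm homogeneous for complex scalars.
   Every complex normed space arises this way; it is a complex Banach space when the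
   carrier type is of class banach, since completeness depends only on the norm. *)
locale complex_normed_space = vector_space scaleC
  for scaleC :: "complex \<Rightarrow> 'a::real_normed_vector \<Rightarrow> 'a" +
  assumes scaleC_of_real: "scaleC (complex_of_real r) x = r *\<^sub>R x"
    and norm_scaleC: "norm (scaleC c x) = cmod c * norm x"

definition bounded_clinear ::
  "(complex \<Rightarrow> 'a::real_normed_vector \<Rightarrow> 'a) \<Rightarrow> ('a \<Rightarrow> 'a) \<Rightarrow> bool" where
  "bounded_clinear scaleC T \<longleftrightarrow>
     Vector_Spaces.linear scaleC scaleC T \<and> (\<exists>K. \<forall>x. norm (T x) \<le> norm x * K)"

(* Meaningful only for m \<ge> 1: for m = 0 the right-hand side is the Max of the empty set. *)
definition m_infty_isometry :: "nat \<Rightarrow> ('a::real_normed_vector \<Rightarrow> 'a) \<Rightarrow> bool" where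
  "m_infty_isometry m T \<longleftrightarrow>
     (\<forall>x. (MAX k\<in>{k \<in> {0..m}. even k}. norm ((T ^^ k) x))
        = (MAX k\<in>{k \<in> {0..m}. odd k}. norm ((T ^^ k) x)))"

lemma complex_normed_space_mult: "complex_normed_space ((*) :: complex \<Rightarrow> complex \<Rightarrow> complex)"
  by unfold_locales (auto simp: algebra_simps norm_mult scaleR_conv_of_real)

lemma (in complex_normed_space) bounded_clinear_imp_bounded_linear:
  assumes "bounded_clinear scaleC T"
  shows "bounded_linear T"
proof -
  from assms have l: "Vector_Spaces.linear scaleC scaleC T"
    and b: "\<exists>K. \<forall>x. norm (T x) \<le> norm x * K"
    by (auto simp: bounded_clinear_def)
  interpret l: Vector_Spaces.linear scaleC scaleC T by (rule l)
  have "T (r *\<^sub>R x) = r *\<^sub>R T x" for r x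
    using l.scale[of "complex_of_real r" x] by (simp add: scaleC_of_real)
  then show ?thesis
    using b by (intro bounded_linear.intro bounded_linear_axioms.intro linearI) (auto simp: l.add)
qed

end

theory Submission
  imports Defs
begin

text \<open>
  Fix \<open>x\<close> and put \<open>a k = norm (T\<^sup>k x)\<close>. The hypothesis for \<open>x\<close> says that the even and the odd
  maxima of \<open>a\<close> over \<open>{0..m}\<close> agree; the hypothesis for \<open>T x\<close> says the same over the shifted
  window \<open>{1..m + 1}\<close>. Passing from \<open>{0..m}\<close> to \<open>{0..m + 1}\<close> adds the single term \<open>a (m + 1)\<close> to
  one of the two maxima, so it suffices that this term does not exceed the common maximum over
  \<open>{0..m}\<close>. By the shifted hypothesis \<open>a (m + 1)\<close> is at most the maximum over those indices in
  \<open>{1..m + 1}\<close> whose parity is opposite to that of \<open>m + 1\<close>; these all lie in \<open>{1..m}\<close>.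

  The argument concerns real sequences only, so one lemma on maps serves both scalar fields.
\<close>

text \<open>
  The bound on the new term. Here \<open>P\<close> is the parity of \<open>m\<close>, so that \<open>m + 1\<close> has parity
  \<open>\<lambda>k. \<not> P k\<close> and becomes the last \<open>P\<close>-term of the shifted sequence; keeping \<open>P\<close> abstract
  treats even and odd \<open>m\<close> at once.
\<close>

lemma next_term_le_Max:
  fixes a :: "nat \<Rightarrow> 'b::linorder"
  assumes alt: "\<And>k. P (Suc k) \<longleftrightarrow> \<not> P k" and "P m" and "m \<ge> 1"
    and shifted: "(MAX k\<in>{k \<in> {0..m}. P k}. a (Suc k)) = (MAX k\<in>{k \<in> {0..m}. \<not> P k}. a (Suc k))"
  shows "a (Suc m) \<le> (MAX k\<in>{k \<in> {0..m}. P k}. a k)"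
proof -
  have "a (Suc m) \<le> (MAX k\<in>{k \<in> {0..m}. P k}. a (Suc k))"
    using \<open>P m\<close> by (intro Max_ge) auto
  also note shifted
  also have "(MAX k\<in>{k \<in> {0..m}. \<not> P k}. a (Suc k)) \<le> (MAX k\<in>{k \<in> {0..m}. P k}. a k)"
  proof (rule Max_mono)
    show "(\<lambda>k. a (Suc k)) ` {k \<in> {0..m}. \<not> P k} \<subseteq> a ` {k \<in> {0..m}. P k}"
    proof (rule image_subsetI)
      fix k assume k: "k \<in> {k \<in> {0..m}. \<not> P k}"
      then have "k \<noteq> m"
        using \<open>P m\<close> by auto
      with k have "Suc k \<in> {k \<in> {0..m}. P k}"
        using alt by simp
      then show "a (Suc k) \<in> a ` {k \<in> {0..m}. P k}"
        by (rule imageI)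
    qed
    have "m - 1 \<in> {k \<in> {0..m}. \<not> P k}"
      using alt[of "m - 1"] \<open>P m\<close> \<open>m \<ge> 1\<close> by simp
    then show "(\<lambda>k. a (Suc k)) ` {k \<in> {0..m}. \<not> P k} \<noteq> {}"
      by blast
  qed simp
  finally show ?thesis .
qed

lemma Max_extend_window:
  fixes a :: "nat \<Rightarrow> 'b::linorder"
  assumes alt: "\<And>k. P (Suc k) \<longleftrightarrow> \<not> P k" and "P m" and "m \<ge> 1"
    and window: "(MAX k\<in>{k \<in> {0..m}. P k}. a k) = (MAX k\<in>{k \<in> {0..m}. \<not> P k}. a k)"
    and shifted: "(MAX k\<in>{k \<in> {0..m}. P k}. a (Suc k)) = (MAX k\<in>{k \<in> {0..m}. \<not> P k}. a (Suc k))"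
  shows "(MAX k\<in>{k \<in> {0..m + 1}. P k}. a k) = (MAX k\<in>{k \<in> {0..m + 1}. \<not> P k}. a k)"
proof -
  have same: "{k \<in> {0..m + 1}. P k} = {k \<in> {0..m}. P k}"
    using alt[of m] \<open>P m\<close> by (auto simp: le_Suc_eq)
  have new: "{k \<in> {0..m + 1}. \<not> P k} = insert (Suc m) {k \<in> {0..m}. \<not> P k}"
    using alt[of m] \<open>P m\<close> by (auto simp: le_Suc_eq)
  have "m - 1 \<in> {k \<in> {0..m}. \<not> P k}"
    using alt[of "m - 1"] \<open>P m\<close> \<open>m \<ge> 1\<close> by simp
  then have "{k \<in> {0..m}. \<not> P k} \<noteq> {}"
    by blast
  then have "(MAX k\<in>{k \<in> {0..m + 1}. \<not> P k}. a k)
      = max (a (Suc m)) (MAX k\<in>{k \<in> {0..m}. \<not> P k}. a k)"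
    unfolding new by simp
  also have "\<dots> = (MAX k\<in>{k \<in> {0..m}. \<not> P k}. a k)"
    using next_term_le_Max[of P m a] assms by (simp add: max_absorb2)
  finally show ?thesis
    using window same by simp
qed

lemma m_infty_isometry_Suc:
  assumes "m \<ge> 1" and isom: "m_infty_isometry m T"
  shows "m_infty_isometry (m + 1) T"
  unfolding m_infty_isometry_def
proof
  fix x
  define a where "a k = norm ((T ^^ k) x)" for k
  have window: "(MAX k\<in>{k \<in> {0..m}. even k}. a k) = (MAX k\<in>{k \<in> {0..m}. odd k}. a k)"
    using isom by (simp add: m_infty_isometry_def a_def)
  have "norm ((T ^^ k) (T x)) = a (Suc k)" for k
    by (simp add: a_def funpow_swap1)
  then have shifted:
    "(MAX k\<in>{k \<in> {0..m}. even k}. a (Suc k)) = (MAX k\<in>{k \<in> {0..m}. odd k}. a (Suc k))"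
    using isom[unfolded m_infty_isometry_def, rule_format, of "T x"] by simp
  have "(MAX k\<in>{k \<in> {0..m + 1}. even k}. a k) = (MAX k\<in>{k \<in> {0..m + 1}. odd k}. a k)"
  proof (cases "even m")
    case True
    then show ?thesis
      using Max_extend_window[of even m a] \<open>m \<ge> 1\<close> window shifted by simp
  next
    case False
    then show ?thesis
      using Max_extend_window[of odd m a] \<open>m \<ge> 1\<close> window shifted by simp
  qed
  then show "(MAX k\<in>{k \<in> {0..m + 1}. even k}. norm ((T ^^ k) x))
      = (MAX k\<in>{k \<in> {0..m + 1}. odd k}. norm ((T ^^ k) x))"
    by (simp add: a_def)
qed

theorem proposition6p3:
  fixes m :: nat
    and T :: "'a::banach \<Rightarrow> 'a"
    and scaleC :: "complex \<Rightarrow> 'b::banach \<Rightarrow> 'b"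
    and S :: "'b \<Rightarrow> 'b"
  assumes "m \<ge> 1"
  shows "(bounded_linear T \<and> m_infty_isometry m T \<longrightarrow> m_infty_isometry (m + 1) T) \<and>
    (complex_normed_space scaleC \<and> bounded_clinear scaleC S \<and> m_infty_isometry m S
      \<longrightarrow> m_infty_isometry (m + 1) S)"
  by (intro conjI impI; elim conjE; rule m_infty_isometry_Suc[OF assms])

end
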